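(* Let $\alpha$ denote the arrow pattern $(12;1\to 3)$, and for $n\ge 1$ let $a_n(321,\alpha)$ be the number of permutations in $\mathfrak{S}_n$ that avoid both the classical pattern $321$ and the arrow pattern $\alpha$. Then for every integer $n\ge2$, $$a_n(321,\alpha)=F_{2n-1},$$ where $F_n$ is the $n$-th Fibonacci number ($F_1=F_2=1$, $F_n=F_{n-1}+F_{n-2}$).
   Context: $\mathfrak{S}_n$ is the set of permutations of $[n]=\{1,\dots,n\}$, written in one-line notation $\sigma=\sigma_1\cdots\sigma_n$ with $\sigma_i=\sigma(i)$. A permutation $\sigma\in\mathfrak{S}_n$ contains the classical pattern $\pi\in\mathfrak{S}_m$ if there are $1\le i_1<\cdots<i_m\le n$ such that $\sigma_{i_1}\cdots\sigma_{i_m}$ is order-isomorphic to $\pi$; otherwise it avoids $\pi$. Standard cycle notation: every cycle (including fixed points) is written as $(a\ \sigma(a)\ \sigma^2(a)\cdots)$ beginning with its maximal element $a$, and the cycles are listed from left to right in increasing order of their maximal elements. The bijection $\Phi:\mathfrak{S}_n\to\mathfrak{S}_n$ sends $\sigma$ to the permutation whose one-line notation is obtained by erasing the parentheses in the standard cycle notation of $\sigma$. For $\sigma\in\mathfrak{S}_n$ write $\hat\sigma=\Phi^{-1}(\sigma)$. An arrow pattern of size $k$ is a pair $(\nu;H)$ with $\nu=a_1\ldots a_m$ a string of positive integers and $H=\{b_i\to c_i:1\le i\le h\}$ a (possibly empty) set of arrows, such that the distinct integers appearing in $\nu$ or $H$ form $[k]$. A permutation $\sigma\in\mathfrak{S}_n$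 contains $(\nu;H)$ if there is a subset $X=\{x_1<\cdots<x_k\}\subseteq[n]$ such that (1) $\sigma_{t_1}\cdots\sigma_{t_m}=x_{a_1}\cdots x_{a_m}$ for some indices $t_1<\cdots<t_m$, and (2) $\hat\sigma(x_{b_i})=x_{c_i}$ for all $1\le i\le h$; otherwise $\sigma$ avoids it. In particular, $\sigma$ contains $\alpha=(12;1\to3)$ iff there exist $x_1<x_2<x_3$ in $[n]$ such that $x_1$ appears to the left of $x_2$ in the one-line notation of $\sigma$ and $\hat\sigma(x_1)=x_3$. *)

theory Defs
  imports
    "HOL-Combinatorics.Combinatorics"
    "HOL-Library.Sublist"
    "HOL-Number_Theory.Fib"
begin

text \<open>
  The symmetric group on \<open>[n]\<close> is the set of functions \<open>\<sigma>\<close> with \<^term>\<open>\<sigma> permutes {1..n}\<close>;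
  letters and positions are numbered from 1. Classical patterns are given in one-line notation.
\<close>

definition one_line :: "nat \<Rightarrow> (nat \<Rightarrow> nat) \<Rightarrow> nat list" where
  "one_line n \<sigma> = map \<sigma> [1..<Suc n]"

definition order_isomorphic :: "nat list \<Rightarrow> nat list \<Rightarrow> bool" where
  "order_isomorphic xs ys \<longleftrightarrow> length xs = length ys \<and>
     (\<forall>i<length xs. \<forall>j<length xs. xs ! i < xs ! j \<longleftrightarrow> ys ! i < ys ! j)"

definition contains_pattern :: "nat \<Rightarrow> (nat \<Rightarrow> nat) \<Rightarrow> nat list \<Rightarrow> bool" where
  "contains_pattern n \<sigma> \<pi> \<longleftrightarrow> (\<exists>ys. subseq ys (one_line n \<sigma>) \<and> order_isomorphic ys \<pi>)"


text \<open>
  The library's \<^term>\<open>support \<sigma> a\<close> is the list \<open>[a, \<sigma> a, \<sigma>\<^sup>2 a, \<dots>]\<close> that runs once through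
  the cycle of \<open>a\<close>; it is \<open>[a]\<close> when \<open>a\<close> is a fixed point.
\<close>

definition standard_cycles :: "nat \<Rightarrow> (nat \<Rightarrow> nat) \<Rightarrow> nat list list" where
  "standard_cycles n \<sigma> =
     map (support \<sigma>) (sorted_list_of_set {a \<in> {1..n}. a = Max (set (support \<sigma> a))})"

definition Phi :: "nat \<Rightarrow> (nat \<Rightarrow> nat) \<Rightarrow> (nat \<Rightarrow> nat)" where
  "Phi n \<sigma> = (\<lambda>i. if i \<in> {1..n} then concat (standard_cycles n \<sigma>) ! (i - 1) else i)"

text \<open>
  Since \<^term>\<open>Phi n\<close> is a bijection from the symmetric group on \<open>[n]\<close> to itself, the choice in
  \<^const>\<open>inv_into\<close> below is unique.
\<close>

definition hat :: "nat \<Rightarrow> (nat \<Rightarrow> nat) \<Rightarrow> (nat \<Rightarrow> nat)" where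
  "hat n \<sigma> = inv_into {\<tau>. \<tau> permutes {1..n}} (Phi n) \<sigma>"


text \<open>
  An arrow pattern \<open>(\<nu>; H)\<close> is a pair of a word and a finite set of arrows, where
  \<^term>\<open>(b, c) \<in> H\<close> stands for \<open>b \<rightarrow> c\<close>.
\<close>

type_synonym arrow_pattern = "nat list \<times> (nat \<times> nat) set"

definition arrow_letters :: "arrow_pattern \<Rightarrow> nat set" where
  "arrow_letters p = set (fst p) \<union> Field (snd p)"

definition arrow_size :: "arrow_pattern \<Rightarrow> nat" where
  "arrow_size p = card (arrow_letters p)"

definition is_arrow_pattern :: "arrow_pattern \<Rightarrow> bool" where
  "is_arrow_pattern p \<longleftrightarrow> finite (snd p) \<and> arrow_letters p = {1..arrow_size p}"

text \<open>
  The subset \<open>X = {x\<^sub>1 < \<dots> < x\<^sub>k}\<close> of \<open>[n]\<close> is given by its increasing enumeration \<open>x\<close>.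
  The definition is meant for \<open>p\<close> with \<^term>\<open>is_arrow_pattern p\<close>.
\<close>

definition contains_arrow_pattern :: "nat \<Rightarrow> (nat \<Rightarrow> nat) \<Rightarrow> arrow_pattern \<Rightarrow> bool" where
  "contains_arrow_pattern n \<sigma> p \<longleftrightarrow>
     (\<exists>x. strict_mono_on {1..arrow_size p} x \<and> x ` {1..arrow_size p} \<subseteq> {1..n} \<and>
          subseq (map x (fst p)) (one_line n \<sigma>) \<and>
          (\<forall>(b, c) \<in> snd p. hat n \<sigma> (x b) = x c))"

definition avoider_count :: "nat \<Rightarrow> nat list \<Rightarrow> arrow_pattern \<Rightarrow> nat" where
  "avoider_count n \<pi> p =
     card {\<sigma>. \<sigma> permutes {1..n} \<and> \<not> contains_pattern n \<sigma> \<pi> \<and> \<not> contains_arrow_pattern n \<sigma> p}"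

definition alpha :: arrow_pattern where
  "alpha = ([1, 2], {(1, 3)})"

lemma arrow_letters_alpha: "arrow_letters alpha = {1..3}"
  by (auto simp: arrow_letters_def alpha_def)

lemma is_arrow_pattern_alpha: "is_arrow_pattern alpha"
  using arrow_letters_alpha by (simp add: is_arrow_pattern_def arrow_size_def alpha_def)

lemma contains_alpha_iff:
  "contains_arrow_pattern n \<sigma> alpha \<longleftrightarrow>
     (\<exists>x y. 1 \<le> x \<and> x < y \<and> y < hat n \<sigma> x \<and> hat n \<sigma> x \<le> n \<and> subseq [x, y] (one_line n \<sigma>))"
  (is "?L \<longleftrightarrow> ?R")
proof
  have I: "{1..arrow_size alpha} = {1, 2, 3}"
    by (auto simp: arrow_size_def arrow_letters_alpha)
  show ?R if ?L
  proof -
    from that obtain x :: "nat \<Rightarrow> nat" where "strict_mono_on {1, 2, 3} x" "x ` {1, 2, 3} \<subseteq> {1..n}"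
      "subseq [x 1, x 2] (one_line n \<sigma>)" "hat n \<sigma> (x 1) = x 3"
      unfolding contains_arrow_pattern_def I by (auto simp: alpha_def)
    then show ?R
      by (intro exI[of _ "x 1"] exI[of _ "x 2"]) (auto simp: strict_mono_on_def)
  qed
  show ?L if ?R
  proof -
    from that obtain a b where ab: "1 \<le> a" "a < b" "b < hat n \<sigma> a" "hat n \<sigma> a \<le> n"
      "subseq [a, b] (one_line n \<sigma>)"
      by blast
    define x where "x = (\<lambda>i::nat. if i = 1 then a else if i = 2 then b else hat n \<sigma> a)"
    have "strict_mono_on {1, 2, 3} x" "x ` {1, 2, 3} \<subseteq> {1..n}"
      using ab by (auto simp: strict_mono_on_def x_def)
    then show ?L
      using ab unfolding contains_arrow_pattern_def I
      by (intro exI[of _ x]) (auto simp: alpha_def x_def)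
  qed
qed

end

theory Submission
  imports Defs
begin

text \<open>
  The map \<^const>\<open>hat\<close> cuts the one-line word \<open>w\<close> of \<open>\<sigma>\<close> into blocks, one in front of each
  left-to-right maximum, and turns each block into a cycle. Hence the image under \<^const>\<open>hat\<close> of the
  letter at position \<open>i\<close> is the next letter, or the head of the block when \<open>i\<close> ends a block; and the
  head of the block is the maximum of the prefix that ends at \<open>i\<close>. This rule determines \<open>\<tau>\<close> from the
  word of \<^term>\<open>Phi n \<tau>\<close>, so \<^const>\<open>Phi\<close> is injective on a finite set, hence bijective, and the rule
  holds for \<^const>\<open>hat\<close> (\<open>hat_one_line\<close>).

  For permutations that avoid 321, the arrow pattern is then a classical one. Suppose that \<open>x\<close> comes
  before \<open>y\<close> and \<open>x < y < z\<close>, where \<open>z\<close> is the image of \<open>x\<close>. If \<open>z\<close> were the next letter after \<open>x\<close> and no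
  left-to-right maximum, the head of its block together with \<open>z\<close> and \<open>y\<close> would form 321. So \<open>x\<close> ends a
  block with head \<open>z\<close>, and \<open>z\<close>, \<open>x\<close>, the head of the next block, and \<open>y\<close> form 3142. Conversely, in an
  occurrence \<open>c a d b\<close> of 3142 the letter just before the first left-to-right maximum after \<open>a\<close>, together
  with \<open>b\<close>, yields the arrow pattern (\<open>contains_alpha_iff_3142\<close>).

  The words on \<open>[n]\<close> that avoid 321 and 3142 are counted by a generation rule. Let \<open>a\<^sub>n\<close> be their
  number and \<open>c\<^sub>n\<close> the number of those that do not end with \<open>n\<close>, for \<open>n \<ge> 1\<close>. A word on \<open>[n+1]\<close> of the class ends with
  \<open>n+1\<close>, or ends with \<open>n\<close>, or has \<open>n+1\<close> immediately after \<open>n\<close> and not at the end. Deleting the letter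
  named first in each of these cases (and renaming \<open>n+1\<close> to \<open>n\<close> in the second) gives bijections that
  yield \<open>c\<^sub>n\<^sub>+\<^sub>1 = a\<^sub>n + c\<^sub>n\<close> and \<open>a\<^sub>n\<^sub>+\<^sub>1 = a\<^sub>n + c\<^sub>n\<^sub>+\<^sub>1\<close>, which is the Fibonacci
  recurrence; with \<open>a\<^sub>1 = 1\<close> and \<open>c\<^sub>1 = 0\<close> it gives \<open>a\<^sub>n = F\<^sub>2\<^sub>n\<^sub>-\<^sub>1\<close> (\<open>card_avoiders_fib\<close>).
\<close>

section \<open>Occurrences of patterns in words\<close>

text \<open>
  Words of the form \<^term>\<open>map f [m..<n]\<close> are closed under taking the part after a chosen position,
  so that rewriting with this equivalence turns an occurrence of a word into a chain of positions.
\<close>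

lemma subseq_Cons_map_upt:
  "subseq (x # xs) (map f [m..<n]) \<longleftrightarrow>
     (\<exists>i<n. m \<le> i \<and> f i = x \<and> subseq xs (map f [Suc i..<n]))"
proof
  assume "subseq (x # xs) (map f [m..<n])"
  then show "\<exists>i<n. m \<le> i \<and> f i = x \<and> subseq xs (map f [Suc i..<n])"
  proof (induction "n - m" arbitrary: m)
    case 0
    then show ?case by simp
  next
    case (Suc d)
    then have mn: "m < n" and d: "d = n - Suc m" by auto
    show ?case
    proof (cases "f m = x")
      case True
      with Suc.prems mn show ?thesis by (auto simp: upt_conv_Cons)
    next
      case False
      with Suc.prems mn have "subseq (x # xs) (map f [Suc m..<n])"
        by (auto simp: upt_conv_Cons dest: subseq_Cons2_neq)
      from Suc.hyps(1)[OF d this] show ?thesis using Suc_leD by blast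
    qed
  qed
next
  assume "\<exists>i<n. m \<le> i \<and> f i = x \<and> subseq xs (map f [Suc i..<n])"
  then obtain i where i: "m \<le> i" "i < n" "f i = x" "subseq xs (map f [Suc i..<n])" by blast
  have "[m..<n] = [m..<i] @ i # [Suc i..<n]"
    using i upt_add_eq_append[of m i "n - i"] by (simp add: upt_conv_Cons)
  then show "subseq (x # xs) (map f [m..<n])" using i by auto
qed

lemma subseq_Cons_nth:
  "subseq (x # xs) w \<longleftrightarrow>
     (\<exists>i<length w. w ! i = x \<and> subseq xs (map (nth w) [Suc i..<length w]))"
  using subseq_Cons_map_upt[of x xs "nth w" 0 "length w"] by (simp only: map_nth) simp

lemma subseq_2_iff:
  "subseq [a, b] w \<longleftrightarrow> (\<exists>i<length w. w ! i = a \<and> (\<exists>j<length w. i < j \<and> w ! j = b))"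
  by (simp only: subseq_Cons_nth[of a "[b]" w] subseq_Cons_map_upt list_emb_Nil Suc_le_eq simp_thms)

lemma subseq_3_iff:
  "subseq [a, b, c] w \<longleftrightarrow>
     (\<exists>i<length w. w ! i = a \<and> (\<exists>j<length w. i < j \<and> w ! j = b \<and>
       (\<exists>k<length w. j < k \<and> w ! k = c)))"
  by (simp only: subseq_Cons_nth[of a "[b, c]" w] subseq_Cons_map_upt list_emb_Nil Suc_le_eq simp_thms)

lemma subseq_4_iff:
  "subseq [a, b, c, d] w \<longleftrightarrow>
     (\<exists>i<length w. w ! i = a \<and> (\<exists>j<length w. i < j \<and> w ! j = b \<and>
       (\<exists>k<length w. j < k \<and> w ! k = c \<and> (\<exists>l<length w. k < l \<and> w ! l = d))))"
  by (simp only: subseq_Cons_nth[of a "[b, c, d]" w] subseq_Cons_map_upt list_emb_Nil Suc_le_eq simp_thms)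

definition has_321 :: "nat list \<Rightarrow> bool" where
  "has_321 w \<longleftrightarrow> (\<exists>a b c. a < b \<and> b < c \<and> subseq [c, b, a] w)"

definition has_3142 :: "nat list \<Rightarrow> bool" where
  "has_3142 w \<longleftrightarrow> (\<exists>a b c d. a < b \<and> b < c \<and> c < d \<and> subseq [c, a, d, b] w)"

lemma has_321_nthI:
  assumes "i < j" "j < k" "k < length w" "w ! i > w ! j" "w ! j > w ! k"
  shows "has_321 w"
proof -
  have "i < length w" "j < length w" using assms by simp_all
  with assms show ?thesis unfolding has_321_def subseq_3_iff by blast
qed

lemma has_3142_nthI:
  assumes "i < j" "j < k" "k < l" "l < length w"
    "w ! j < w ! l" "w ! l < w ! i" "w ! i < w ! k"
  shows "has_3142 w"
proof -
  have "i < length w" "j < length w" "k < length w" using assms by simp_all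
  with assms show ?thesis unfolding has_3142_def subseq_4_iff by blast
qed

lemma contains_321_iff: "contains_pattern n \<sigma> [3, 2, 1] \<longleftrightarrow> has_321 (one_line n \<sigma>)"
proof -
  have "order_isomorphic ys [3, 2, 1] \<longleftrightarrow> (\<exists>a b c. a < b \<and> b < c \<and> ys = [c, b, a])" for ys
  proof
    assume iso: "order_isomorphic ys [3, 2, 1]"
    then have "length ys = 3" by (simp add: order_isomorphic_def)
    then obtain c b a where ys: "ys = [c, b, a]"
      by (auto simp: numeral_3_eq_3 length_Suc_conv)
    have less: "ys ! i < ys ! j \<longleftrightarrow> [3, 2, 1::nat] ! i < [3, 2, 1] ! j" if "i < 3" "j < 3" for i j
      using iso that unfolding order_isomorphic_def ys by simp
    from less[of 2 1] less[of 1 0] show "\<exists>a b c. a < b \<and> b < c \<and> ys = [c, b, a]"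
      by (simp add: ys)
  next
    assume "\<exists>a b c. a < b \<and> b < c \<and> ys = [c, b, a]"
    then obtain a b c where "a < b" "b < c" "ys = [c, b, a]" by blast
    then show "order_isomorphic ys [3, 2, 1]"
      by (simp add: order_isomorphic_def All_less_Suc numeral_3_eq_3)
  qed
  then show ?thesis unfolding contains_pattern_def has_321_def by metis
qed

section \<open>Reading a permutation off its Foata word\<close>

text \<open>
  The image of the letter at position \<open>i\<close> (counted from 0) when the blocks of \<open>w\<close> are read as cycles.
  The next letter starts a
  new block exactly when it exceeds the maximum of the prefix, and otherwise that maximum is the head
  of the block of position \<open>i\<close>.
\<close>

definition foata_next :: "nat list \<Rightarrow> nat \<Rightarrow> nat" where
  "foata_next w i =
     (let M = Max (set (take (Suc i) w))
      in if Suc i < length w \<and> w ! Suc i < M then w ! Suc i else M)"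

text \<open>
  Heads increase and dominate their blocks, so the maximum of every prefix is the head of the block
  in which the prefix ends. Adding blocks at the end changes \<^const>\<open>foata_next\<close> at no earlier position:
  at the last position of the old word the new neighbour is a larger head and is ignored.
\<close>

lemma foata_next_concat:
  assumes "\<And>B. B \<in> set Bs \<Longrightarrow> B \<noteq> [] \<and> (\<forall>x\<in>set (tl B). x < hd B) \<and> map f B = tl B @ [hd B]"
    and "sorted_wrt (<) (map hd Bs)"
    and "i < length (concat Bs)"
  shows "f (concat Bs ! i) = foata_next (concat Bs) i"
  using assms
proof (induction Bs rule: rev_induct)
  case Nil
  then show ?case by simp
next
  case (snoc B Bs)
  define w where "w = concat Bs"
  have B: "B \<noteq> []" "\<forall>x\<in>set (tl B). x < hd B" "map f B = tl B @ [hd B]"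
    using snoc.prems(1)[of B] by auto
  have le_hd: "x \<le> hd C" if "C \<in> set (Bs @ [B])" "x \<in> set C" for C x
    using snoc.prems(1)[OF that(1)] that(2) by (cases C) auto
  have below: "x < hd B" if "x \<in> set w" for x
  proof -
    from that obtain C where "C \<in> set Bs" "x \<in> set C" by (auto simp: w_def)
    with le_hd[of C x] snoc.prems(2) show ?thesis
      by (auto simp: sorted_wrt_append dest: order.strict_trans1)
  qed
  show ?case
  proof (cases "i < length w")
    case True
    have IH: "f (w ! i) = foata_next w i"
      unfolding w_def by (rule snoc.IH) (use snoc.prems True in \<open>auto simp: w_def sorted_wrt_append\<close>)
    have "foata_next (w @ B) i = foata_next w i"
    proof (cases "Suc i < length w")
      case True
      then show ?thesis by (simp add: foata_next_def Let_def nth_append)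
    next
      case False
      with True have len: "length w = Suc i" by simp
      have "Max (set w) < hd B" using True below by (subst Max_less_iff) auto
      then show ?thesis using len B(1) by (simp add: foata_next_def nth_append hd_conv_nth Let_def)
    qed
    with IH True show ?thesis by (simp add: w_def nth_append)
  next
    case False
    define k where "k = i - length w"
    have k: "k < length B" "i = length w + k" using False snoc.prems(3) by (auto simp: k_def w_def)
    have hd_in: "hd B \<in> set (take (Suc k) B)" using B(1) by (cases B) auto
    have "Max (set (take (Suc i) (w @ B))) = hd B"
    proof (rule Max_eqI)
      show "hd B \<in> set (take (Suc i) (w @ B))" using hd_in k by simp
      show "y \<le> hd B" if "y \<in> set (take (Suc i) (w @ B))" for y
      proof -
        have "y \<in> set w \<or> y \<in> set B" using in_set_takeD[OF that] by auto
        then show ?thesis using below le_hd[of B] by (auto intro: less_imp_le)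
      qed
    qed simp
    then have next_eq: "foata_next (w @ B) i = (if Suc k < length B \<and> B ! Suc k < hd B then B ! Suc k else hd B)"
      using k by (simp add: foata_next_def nth_append Let_def)
    have "f (B ! k) = map f B ! k" using k(1) by simp
    also have "\<dots> = (tl B @ [hd B]) ! k" by (simp only: B(3))
    also have "\<dots> = (if Suc k < length B then B ! Suc k else hd B)"
      using k(1) by (auto simp: nth_append nth_tl)
    also have "\<dots> = foata_next (w @ B) i"
    proof (cases "Suc k < length B")
      case True
      then have "tl B ! k \<in> set (tl B)" by (intro nth_mem) simp
      then have "B ! Suc k < hd B" using B(2) True by (simp add: nth_tl)
      with True show ?thesis by (simp add: next_eq)
    next
      case False
      then show ?thesis by (simp add: next_eq)
    qed
    finally show ?thesis using k(2) by (simp add: w_def nth_append)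
  qed
qed

lemma map_support:
  assumes "permutation p"
  shows "map p (support p a) = tl (support p a) @ [a]"
proof -
  have "map p (support p a) = map (cycle_of_list (support p a)) (support p a)"
    using cycle_restrict[OF assms] by (intro map_cong) blast+
  also have "\<dots> = rotate1 (support p a)"
    using cyclic_rotation[OF cycle_of_permutation[OF assms], of 1 a] by simp
  also have "\<dots> = tl (support p a) @ [a]"
    using least_power_of_permutation(2)[OF assms, of a]
    by (simp add: rotate1_hd_tl hd_map)
  finally show ?thesis .
qed

definition foata_word :: "nat \<Rightarrow> (nat \<Rightarrow> nat) \<Rightarrow> nat list" where
  "foata_word n \<tau> = concat (standard_cycles n \<tau>)"

context
  fixes n :: nat and \<tau> :: "nat \<Rightarrow> nat"
  assumes perm: "\<tau> permutes {1..n}"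
begin

lemma permutation_of_interval: "permutation \<tau>"
  using perm by (auto simp: permutation_permutes)

lemma support_self: "a \<in> set (support \<tau> a)"
  using least_power_of_permutation(2)[OF permutation_of_interval, of a] by force

lemma support_not_Nil: "support \<tau> a \<noteq> []"
  using least_power_of_permutation(2)[OF permutation_of_interval, of a] by simp

lemma hd_support: "hd (support \<tau> a) = a"
  using least_power_of_permutation(2)[OF permutation_of_interval, of a] by (simp add: hd_map)

lemma distinct_support: "distinct (support \<tau> a)"
  by (rule cycle_of_permutation[OF permutation_of_interval])

lemma support_eq: "b \<in> set (support \<tau> a) \<Longrightarrow> set (support \<tau> b) = set (support \<tau> a)"
  using disjoint_support[OF permutation_of_interval] support_self[of b] unfolding disjoint_def by blast

lemma support_subset: "a \<in> {1..n} \<Longrightarrow> set (support \<tau> a) \<subseteq> {1..n}"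
  using permutes_in_funpow_image[OF perm] by auto

definition cycle_maxima :: "nat set" where
  "cycle_maxima = {a \<in> {1..n}. a = Max (set (support \<tau> a))}"

lemma finite_cycle_maxima: "finite cycle_maxima"
  by (simp add: cycle_maxima_def)

lemma standard_cycles_eq:
  "standard_cycles n \<tau> = map (support \<tau>) (sorted_list_of_set cycle_maxima)"
  by (simp add: standard_cycles_def cycle_maxima_def)

lemma set_foata_word: "set (foata_word n \<tau>) = {1..n}"
proof -
  have "set (foata_word n \<tau>) = (\<Union>a\<in>cycle_maxima. set (support \<tau> a))"
    using finite_cycle_maxima by (simp add: foata_word_def standard_cycles_eq)
  also have "\<dots> = {1..n}"
  proof (intro equalityI subsetI)
    fix b assume "b \<in> (\<Union>a\<in>cycle_maxima. set (support \<tau> a))"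
    then obtain a where "a \<in> {1..n}" "b \<in> set (support \<tau> a)"
      by (auto simp only: cycle_maxima_def)
    then show "b \<in> {1..n}" using support_subset by blast
  next
    fix b assume b: "b \<in> {1..n}"
    define a where "a = Max (set (support \<tau> b))"
    have a: "a \<in> set (support \<tau> b)" unfolding a_def
      by (rule Max_in) (simp_all only: List.finite_set set_empty support_not_Nil not_False_eq_True)
    have "set (support \<tau> a) = set (support \<tau> b)" using a by (rule support_eq)
    moreover have "a \<in> {1..n}" using a support_subset[OF b] by blast
    ultimately have "a \<in> cycle_maxima" "b \<in> set (support \<tau> a)"
      unfolding cycle_maxima_def mem_Collect_eq using support_self[of b] a_def by simp_all
    then show "b \<in> (\<Union>a\<in>cycle_maxima. set (support \<tau> a))" by blast
  qed
  finally show ?thesis .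
qed

lemma distinct_foata_word: "distinct (foata_word n \<tau>)"
  unfolding foata_word_def
proof (rule distinct_concat)
  have "inj_on (support \<tau>) cycle_maxima" by (rule inj_on_inverseI[where g = hd]) (rule hd_support)
  then show "distinct (standard_cycles n \<tau>)"
    using finite_cycle_maxima by (simp add: standard_cycles_eq distinct_map)
  show "distinct ys" if "ys \<in> set (standard_cycles n \<tau>)" for ys
    using that distinct_support finite_cycle_maxima by (auto simp only: standard_cycles_eq set_map)
  fix ys zs
  assume yz: "ys \<in> set (standard_cycles n \<tau>)" "zs \<in> set (standard_cycles n \<tau>)" "ys \<noteq> zs"
  then obtain a b where ab: "a \<in> cycle_maxima" "ys = support \<tau> a" "b \<in> cycle_maxima" "zs = support \<tau> b"
    using finite_cycle_maxima by (auto simp only: standard_cycles_eq set_map set_sorted_list_of_set)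
  show "set ys \<inter> set zs = {}"
  proof (rule ccontr)
    assume "set ys \<inter> set zs \<noteq> {}"
    then obtain c where "c \<in> set (support \<tau> a)" "c \<in> set (support \<tau> b)" using ab by blast
    then have "set (support \<tau> a) = set (support \<tau> b)" using support_eq by metis
    then have "a = b" using ab by (auto simp only: cycle_maxima_def mem_Collect_eq)
    with yz ab show False by simp
  qed
qed

lemma length_foata_word: "length (foata_word n \<tau>) = n"
  using distinct_card[OF distinct_foata_word] set_foata_word by simp

lemma foata_word_next:
  assumes "i < n"
  shows "\<tau> (foata_word n \<tau> ! i) = foata_next (foata_word n \<tau>) i"
  unfolding foata_word_def
proof (rule foata_next_concat)
  fix B assume "B \<in> set (standard_cycles n \<tau>)"
  then obtain a where a: "a \<in> cycle_maxima" "B = support \<tau> a"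
    using finite_cycle_maxima by (auto simp only: standard_cycles_eq set_map set_sorted_list_of_set)
  then obtain bs where eq: "support \<tau> a = a # bs"
    using support_not_Nil[of a] hd_support[of a] by (metis list.collapse)
  have max: "Max (set (a # bs)) = a" using a(1) unfolding eq[symmetric] by (simp add: cycle_maxima_def)
  have "x < a" if x: "x \<in> set bs" for x
  proof -
    have "x \<le> Max (set (a # bs))" using x by (intro Max_ge) auto
    moreover have "x \<noteq> a"
      using x distinct_support[of a] unfolding eq by auto
    ultimately show ?thesis using max by simp
  qed
  then show "B \<noteq> [] \<and> (\<forall>x\<in>set (tl B). x < hd B) \<and> map \<tau> B = tl B @ [hd B]"
    using map_support[OF permutation_of_interval, of a] unfolding a(2) eq by simp
next
  have "map hd (standard_cycles n \<tau>) = sorted_list_of_set cycle_maxima"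
    unfolding standard_cycles_eq map_map by (rule map_idI) (simp only: o_apply hd_support)
  then show "sorted_wrt (<) (map hd (standard_cycles n \<tau>))"
    using strict_sorted_list_of_set[of cycle_maxima] by simp
next
  show "i < length (concat (standard_cycles n \<tau>))"
    using length_foata_word assms by (simp add: foata_word_def)
qed

end

lemma length_one_line [simp]: "length (one_line n \<sigma>) = n"
  by (simp add: one_line_def)

lemma nth_one_line [simp]: "i < n \<Longrightarrow> one_line n \<sigma> ! i = \<sigma> (Suc i)"
  by (simp add: one_line_def del: upt_Suc)

lemma one_line_Phi:
  assumes "\<tau> permutes {1..n}"
  shows "one_line n (Phi n \<tau>) = foata_word n \<tau>"
  by (rule nth_equalityI) (simp_all add: length_foata_word[OF assms] Phi_def flip: foata_word_def)

lemma one_line_bij: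
  "bij_betw (one_line n) {\<sigma>. \<sigma> permutes {1..n}} (permutations_of_set {1..n})"
proof (rule bij_betw_byWitness
    [where f' = "\<lambda>w i. if i \<in> {1..n} then w ! (i - 1) else i"])
  show "\<forall>\<sigma>\<in>{\<sigma>. \<sigma> permutes {1..n}}. (\<lambda>i. if i \<in> {1..n} then one_line n \<sigma> ! (i - 1) else i) = \<sigma>"
    by (auto simp: fun_eq_iff permutes_def)
  show "\<forall>w\<in>permutations_of_set {1..n}.
      one_line n (\<lambda>i. if i \<in> {1..n} then w ! (i - 1) else i) = w"
    by (auto intro!: nth_equalityI dest: length_finite_permutations_of_set)
  show "one_line n ` {\<sigma>. \<sigma> permutes {1..n}} \<subseteq> permutations_of_set {1..n}"
  proof (rule image_subsetI)
    fix \<sigma> assume "\<sigma> \<in> {\<sigma>. \<sigma> permutes {1..n}}"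
    then have \<sigma>: "\<sigma> permutes {1..n}" by simp
    have "set (one_line n \<sigma>) = \<sigma> ` {1..n}"
      by (auto simp: one_line_def simp del: upt_Suc)
    moreover have "distinct (one_line n \<sigma>)"
      using permutes_inj_on[OF \<sigma>] by (auto simp: one_line_def distinct_map simp del: upt_Suc)
    ultimately show "one_line n \<sigma> \<in> permutations_of_set {1..n}"
      using permutes_image[OF \<sigma>] by (simp add: permutations_of_set_def)
  qed
  show "(\<lambda>w i. if i \<in> {1..n} then w ! (i - 1) else i) ` permutations_of_set {1..n}
      \<subseteq> {\<sigma>. \<sigma> permutes {1..n}}"
  proof (rule image_subsetI, rule CollectI)
    fix w assume w: "w \<in> permutations_of_set {1..n}"
    let ?f = "\<lambda>i. if i \<in> {1..n} then w ! (i - 1) else i"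
    have len: "length w = n" and dw: "distinct w" and sw: "set w = {1..n}"
      using w length_finite_permutations_of_set[OF w] by (auto simp: permutations_of_set_def)
    have "inj_on ?f {1..n}"
      using dw len by (auto simp: inj_on_def nth_eq_iff_index_eq)
    moreover have "?f ` {1..n} \<subseteq> {1..n}"
    proof (rule image_subsetI)
      fix i assume i: "i \<in> {1..n}"
      then have "w ! (i - 1) \<in> set w" using len by (intro nth_mem) auto
      then show "?f i \<in> {1..n}" using i sw by simp
    qed
    ultimately have "bij_betw ?f {1..n} {1..n}"
      using endo_inj_surj[of "{1..n}" ?f] unfolding bij_betw_def by blast
    then show "?f permutes {1..n}" by (rule bij_imp_permutes) auto
  qed
qed

text \<open>
  The word determines the image of each of its letters, by \<open>foata_word_next\<close>.
\<close>

lemma inj_on_Phi: "inj_on (Phi n) {\<tau>. \<tau> permutes {1..n}}"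
proof (rule inj_onI, clarify)
  fix \<tau> \<tau>' assume p: "\<tau> permutes {1..n}" "\<tau>' permutes {1..n}" and "Phi n \<tau> = Phi n \<tau>'"
  then have eq: "foata_word n \<tau> = foata_word n \<tau>'" by (metis one_line_Phi)
  show "\<tau> = \<tau>'"
  proof
    fix x
    show "\<tau> x = \<tau>' x"
    proof (cases "x \<in> {1..n}")
      case True
      then obtain i where "i < n" "foata_word n \<tau> ! i = x"
        using set_foata_word[OF p(1)] length_foata_word[OF p(1)] by (metis in_set_conv_nth)
      then show ?thesis using foata_word_next[OF p(1)] foata_word_next[OF p(2)] eq by metis
    next
      case False
      then show ?thesis using p by (simp add: permutes_def)
    qed
  qed
qed

lemma Phi_permutes:
  assumes "\<tau> permutes {1..n}"
  shows "Phi n \<tau> permutes {1..n}"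
proof -
  have "foata_word n \<tau> \<in> permutations_of_set {1..n}"
    using distinct_foata_word[OF assms] set_foata_word[OF assms]
    by (simp add: permutations_of_set_def)
  then obtain \<sigma> where \<sigma>: "\<sigma> permutes {1..n}" "one_line n \<sigma> = foata_word n \<tau>"
    using one_line_bij unfolding bij_betw_def by (metis (no_types, lifting) imageE mem_Collect_eq)
  have "Phi n \<tau> i = \<sigma> i" for i
  proof (cases "i \<in> {1..n}")
    case True
    then have "i - 1 < n" "Suc (i - 1) = i" by auto
    then show ?thesis using \<sigma>(2) one_line_Phi[OF assms] by (metis nth_one_line)
  next
    case False
    then show ?thesis using \<sigma>(1) by (auto simp: Phi_def permutes_def)
  qed
  then show ?thesis using \<sigma>(1) by presburger
qed

lemma hat_one_line:
  assumes "\<sigma> permutes {1..n}" "i < n"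
  shows "hat n \<sigma> (one_line n \<sigma> ! i) = foata_next (one_line n \<sigma>) i"
proof -
  let ?S = "{\<tau>. \<tau> permutes {1..n}}"
  have "Phi n ` ?S = ?S"
    using inj_on_Phi Phi_permutes by (intro endo_inj_surj) (auto simp: finite_permutations)
  then have "\<sigma> \<in> Phi n ` ?S" using assms(1) by simp
  then have "hat n \<sigma> permutes {1..n}" "Phi n (hat n \<sigma>) = \<sigma>"
    unfolding hat_def using inv_into_into[of \<sigma> "Phi n" ?S] by (auto simp: f_inv_into_f)
  then show ?thesis using foata_word_next[of "hat n \<sigma>" n i] one_line_Phi[of "hat n \<sigma>" n] assms(2)
    by simp
qed

section \<open>The arrow pattern and the classical pattern 3142\<close>

lemma nth_le_prefix_Max:
  assumes "i \<le> j" "j < length w"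
  shows "w ! i \<le> Max (set (take (Suc j) w))"
  using assms by (intro Max_ge) (auto simp: in_set_conv_nth intro!: exI[of _ i])

lemma prefix_Max_nth:
  assumes "j < length w"
  obtains i where "i \<le> j" "w ! i = Max (set (take (Suc j) w))"
proof -
  have "Max (set (take (Suc j) w)) \<in> set (take (Suc j) w)"
    using assms by (intro Max_in) (auto simp: take_eq_Nil)
  then show ?thesis using that by (auto simp: in_set_conv_nth less_Suc_eq_le)
qed

text \<open>
  If the arrow goes to the next letter, that letter lies below the prefix maximum and a 321
  appears; so it goes back to the prefix maximum and the next letter is a larger one, which
  supplies the 4.
\<close>

lemma has_3142_if_arrow:
  assumes "distinct w" "\<not> has_321 w"
    and "i < j" "j < length w" "w ! i < w ! j" "w ! j < foata_next w i"
  shows "has_3142 w"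
proof -
  define M where "M = Max (set (take (Suc i) w))"
  obtain m where m: "m \<le> i" "w ! m = M"
    using prefix_Max_nth[of i w] assms unfolding M_def by auto
  show ?thesis
  proof (cases "w ! Suc i < M")
    case True
    then have nx: "foata_next w i = w ! Suc i" using assms by (simp add: foata_next_def M_def)
    then have "Suc i < j" using assms by (metis Suc_lessI less_irrefl)
    then have "has_321 w" using assms m True nx by (intro has_321_nthI[of m "Suc i" j]) auto
    with assms show ?thesis by blast
  next
    case False
    then have nx: "foata_next w i = M" using assms by (simp add: foata_next_def M_def)
    have "m \<noteq> i" using m assms nx by auto
    have "Suc i \<noteq> j" using False assms nx by auto
    moreover have "w ! Suc i \<noteq> w ! m" using assms(1,3,4) m(1) by (simp add: nth_eq_iff_index_eq)
    ultimately show ?thesis using assms m nx False \<open>m \<noteq> i\<close>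
      by (intro has_3142_nthI[of m i "Suc i" j]) auto
  qed
qed

text \<open>
  The tail of the arrow is the end of the block that precedes the first left-to-right maximum after
  the letter 1 of the occurrence. Its block head is at least the letter 3, hence above the letter 2;
  the tail itself lies below the letter 2: it is the letter 1, or else it is no left-to-right maximum
  and, if it exceeded the letter 2, would be the middle of a 321.
\<close>

lemma arrow_if_has_3142:
  assumes "distinct w" "\<not> has_321 w" "has_3142 w"
  obtains i j where "i < j" "j < length w" "w ! i < w ! j" "w ! j < foata_next w i"
proof -
  from assms(3) obtain p q r s where pqrs: "p < q" "q < r" "r < s" "s < length w"
      "w ! q < w ! s" "w ! s < w ! p" "w ! p < w ! r"
    unfolding has_3142_def subseq_4_iff by blast
  \<comment> \<open>a letter that is not a left-to-right maximum has a larger letter before it\<close>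
  have lr: "Max (set (take (Suc k) w)) < w ! Suc k \<or>
      (\<exists>m\<le>k. w ! Suc k < w ! m \<and> w ! m = Max (set (take (Suc k) w)))" if bound: "Suc k < length w" for k
  proof -
    obtain m where m: "m \<le> k" "w ! m = Max (set (take (Suc k) w))"
      using prefix_Max_nth[OF Suc_lessD[OF bound]] by blast
    moreover have "w ! m \<noteq> w ! Suc k" using assms(1) bound m(1) by (simp add: nth_eq_iff_index_eq)
    ultimately show ?thesis by (metis linorder_neqE_nat)
  qed
  obtain r' where r': "r = Suc r'" "q \<le> r'" using pqrs by (cases r) auto
  \<comment> \<open>otherwise a letter above the 4 would precede it, and the 4 and the 2 would complete a 321\<close>
  have "Max (set (take (Suc r') w)) < w ! Suc r'"
    using lr[of r'] assms(2) has_321_nthI[of _ r s w] pqrs r'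
    by (metis le_imp_less_Suc less_trans)
  then have ex: "\<exists>k. q \<le> k \<and> k \<le> r' \<and> Max (set (take (Suc k) w)) < w ! Suc k" using r' by blast
  define i where "i = (LEAST k. q \<le> k \<and> k \<le> r' \<and> Max (set (take (Suc k) w)) < w ! Suc k)"
  define M where "M = Max (set (take (Suc i) w))"
  from LeastI_ex[OF ex] have i: "q \<le> i" "i \<le> r'" "M < w ! Suc i" by (auto simp: i_def M_def)
  have least: "\<not> Max (set (take (Suc k) w)) < w ! Suc k" if "q \<le> k" "k < i" for k
  proof -
    have "k \<le> r'" using that(2) i(2) by simp
    with that(1) not_less_Least[OF that(2)[unfolded i_def]] show ?thesis by blast
  qed
  have i_less_s: "i < s" using i r' pqrs by simp
  have nx: "foata_next w i = M" using i by (simp add: foata_next_def M_def)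
  have "w ! p \<le> M" unfolding M_def using i pqrs i_less_s by (intro nth_le_prefix_Max) auto
  then have sM: "w ! s < M" using pqrs by simp
  \<comment> \<open>by minimality position \<open>i\<close> is the 1 itself or no left-to-right maximum\<close>
  have "w ! i < w ! s"
  proof (cases "i = q")
    case True
    then show ?thesis using pqrs by simp
  next
    case False
    then obtain i' where i': "i = Suc i'" "q \<le> i'" using i by (cases i) auto
    have "\<not> Max (set (take (Suc i') w)) < w ! Suc i'" using least i' by simp
    then obtain m where m: "m \<le> i'" "w ! Suc i' < w ! m"
      using lr[of i'] i' i_less_s pqrs by fastforce
    have "\<not> w ! s < w ! i"
      using has_321_nthI[of m i s w] m i' i_less_s pqrs assms(2) by auto
    moreover have "w ! s \<noteq> w ! i" using assms(1) i_less_s pqrs by (simp add: nth_eq_iff_index_eq)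
    ultimately show ?thesis by simp
  qed
  with that[of i s] i_less_s pqrs sM nx show ?thesis by simp
qed

lemma contains_alpha_iff_3142:
  assumes \<sigma>: "\<sigma> permutes {1..n}" and no321: "\<not> has_321 (one_line n \<sigma>)"
  shows "contains_arrow_pattern n \<sigma> alpha \<longleftrightarrow> has_3142 (one_line n \<sigma>)"
proof -
  define w where "w = one_line n \<sigma>"
  have "w \<in> permutations_of_set {1..n}"
    using one_line_bij \<sigma> unfolding w_def bij_betw_def by blast
  then have w: "distinct w" "set w = {1..n}" "length w = n"
    by (auto simp: permutations_of_set_def w_def)
  have hat: "hat n \<sigma> (w ! i) = foata_next w i" if "i < n" for i
    using hat_one_line[OF \<sigma> that] by (simp add: w_def)
  show ?thesis unfolding contains_alpha_iff w_def[symmetric]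
  proof
    assume "\<exists>x y. 1 \<le> x \<and> x < y \<and> y < hat n \<sigma> x \<and> hat n \<sigma> x \<le> n \<and> subseq [x, y] w"
    then obtain i j where ij: "i < j" "j < length w" "w ! i < w ! j" "w ! j < hat n \<sigma> (w ! i)"
      unfolding subseq_2_iff by blast
    then have "w ! j < foata_next w i" using hat w by simp
    from has_3142_if_arrow[OF w(1) _ ij(1,2,3) this] no321 show "has_3142 w" by (simp add: w_def)
  next
    assume "has_3142 w"
    then obtain i j where ij: "i < j" "j < length w" "w ! i < w ! j" "w ! j < foata_next w i"
      using arrow_if_has_3142 w(1) no321 unfolding w_def by blast
    have "1 \<le> w ! i" using nth_mem[of i w] ij w(2) by auto
    moreover have "foata_next w i \<le> n"
    proof -
      have "foata_next w i \<in> set w"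
      proof -
        have "Max (set (take (Suc i) w)) \<in> set (take (Suc i) w)"
          using ij by (intro Max_in) (auto simp: take_eq_Nil)
        then show ?thesis using ij by (auto simp: foata_next_def Let_def dest: in_set_takeD)
      qed
      then show ?thesis using w by simp
    qed
    moreover have "subseq [w ! i, w ! j] w"
      using ij less_trans[OF ij(1,2)] unfolding subseq_2_iff by blast
    moreover have "hat n \<sigma> (w ! i) = foata_next w i" using hat[of i] ij w(3) by simp
    ultimately show "\<exists>x y. 1 \<le> x \<and> x < y \<and> y < hat n \<sigma> x \<and> hat n \<sigma> x \<le> n \<and> subseq [x, y] w"
      using ij by (intro exI[of _ "w ! i"] exI[of _ "w ! j"]) simp
  qed
qed

section \<open>Counting words that avoid 321 and 3142\<close>

definition avoids_both :: "nat list \<Rightarrow> bool" where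
  "avoids_both w \<longleftrightarrow> \<not> has_321 w \<and> \<not> has_3142 w"

lemma avoids_both_subseq: "avoids_both w \<Longrightarrow> subseq v w \<Longrightarrow> avoids_both v"
  unfolding avoids_both_def has_321_def has_3142_def by (meson subseq_order.order_trans)

lemma avoids_both_map:
  assumes "strict_mono_on A f" "set w \<subseteq> A" "avoids_both w"
  shows "avoids_both (map f w)"
proof -
  have less: "x < y" if "f x < f y" "x \<in> A" "y \<in> A" for x y
    using assms(1) that by (metis strict_mono_on_less)
  have sub: "\<exists>zs. ys = map f zs \<and> subseq zs w \<and> set zs \<subseteq> A" if "subseq ys (map f w)" for ys
    using that assms(2)
    by (metis nths_map set_nths_subset subseq_conv_nths subset_trans)
  show ?thesis
    unfolding avoids_both_def
  proof
    show "\<not> has_321 (map f w)"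
    proof
      assume "has_321 (map f w)"
      then obtain a b c where abc: "a < b" "b < c" "subseq [c, b, a] (map f w)"
        unfolding has_321_def by blast
      from sub[OF abc(3)] obtain a' b' c' where
        "a = f a'" "b = f b'" "c = f c'" "subseq [c', b', a'] w" "{a', b', c'} \<subseteq> A"
        by (auto simp: Cons_eq_map_conv)
      with abc less[of a' b'] less[of b' c'] have "has_321 w" unfolding has_321_def by blast
      with assms(3) show False by (simp add: avoids_both_def)
    qed
    show "\<not> has_3142 (map f w)"
    proof
      assume "has_3142 (map f w)"
      then obtain a b c d where abc: "a < b" "b < c" "c < d" "subseq [c, a, d, b] (map f w)"
        unfolding has_3142_def by blast
      from sub[OF abc(4)] obtain a' b' c' d' where
        "a = f a'" "b = f b'" "c = f c'" "d = f d'" "subseq [c', a', d', b'] w" "{a', b', c', d'} \<subseteq> A"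
        by (auto simp: Cons_eq_map_conv)
      with abc less[of a' b'] less[of b' c'] less[of c' d'] have "has_3142 w"
        unfolding has_3142_def by blast
      with assms(3) show False by (simp add: avoids_both_def)
    qed
  qed
qed

lemma set_subseq: "subseq xs ys \<Longrightarrow> set xs \<subseteq> set ys"
  by (metis subseq_conv_nths set_nths_subset)

text \<open>
  In both patterns two larger letters precede the last one, so a new last letter with at most one
  larger letter before it completes neither.
\<close>

lemma avoids_both_snoc:
  assumes "avoids_both v"
    and unique: "\<And>x y. x \<in> set v \<Longrightarrow> y \<in> set v \<Longrightarrow> m < x \<Longrightarrow> m < y \<Longrightarrow> x = y"
  shows "avoids_both (v @ [m])"
proof -
  have last: "subseq (ys @ [y]) v \<or> y = m \<and> subseq ys v"
    if "subseq (ys @ [y]) (v @ [m])" for ys y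
  proof (cases "y = m")
    case True
    with that show ?thesis by simp
  next
    case False
    from that obtain xs1 xs2 where xs: "ys @ [y] = xs1 @ xs2" "subseq xs1 v" "subseq xs2 [m]"
      unfolding subseq_append_iff by blast
    have "xs2 = []"
    proof (rule ccontr)
      assume "xs2 \<noteq> []"
      then have "last xs2 \<in> set xs2" "last xs2 = y" using xs(1) by (simp, metis last_appendR last_snoc)
      then show False using False set_subseq[OF xs(3)] by auto
    qed
    with xs show ?thesis by simp
  qed
  show ?thesis
    unfolding avoids_both_def
  proof
    show "\<not> has_321 (v @ [m])"
    proof
      assume "has_321 (v @ [m])"
      then obtain a b c where abc: "a < b" "b < c" "subseq [c, b, a] (v @ [m])"
        unfolding has_321_def by blast
      have "\<not> subseq [c, b, a] v" using assms(1) abc unfolding avoids_both_def has_321_def by blast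
      with last[of "[c, b]" a] abc(3) have "a = m" "subseq [c, b] v" by auto
      moreover from this have "c \<in> set v" "b \<in> set v" by (auto dest: set_subseq)
      ultimately show False using unique[of b c] abc by simp
    qed
    show "\<not> has_3142 (v @ [m])"
    proof
      assume "has_3142 (v @ [m])"
      then obtain a b c d where abc: "a < b" "b < c" "c < d" "subseq [c, a, d, b] (v @ [m])"
        unfolding has_3142_def by blast
      have "\<not> subseq [c, a, d, b] v" using assms(1) abc unfolding avoids_both_def has_3142_def by blast
      with last[of "[c, a, d]" b] abc(4) have "b = m" "subseq [c, a, d] v" by auto
      moreover from this have "c \<in> set v" "d \<in> set v" by (auto dest: set_subseq)
      ultimately show False using unique[of c d] abc by simp
    qed
  qed
qed

lemma subseq_Cons_middle: "subseq xs vs \<Longrightarrow> subseq (x # xs) (us @ x # vs)"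
  by (simp add: list_emb_append2)

lemma subseq_Cons_after:
  "x \<notin> set us \<Longrightarrow> subseq (x # xs) (us @ x # vs) \<longleftrightarrow> subseq xs vs"
  by (induction us) auto

lemma subseq_filter_neq:
  assumes "subseq ys w" "a \<notin> set ys"
  shows "subseq ys (filter (\<lambda>x. x \<noteq> a) w)"
proof -
  have "filter (\<lambda>x. x \<noteq> a) ys = ys" using assms(2) by (auto simp: filter_id_conv)
  with subseq_filter[OF assms(1), of "\<lambda>x. x \<noteq> a"] show ?thesis by simp
qed

text \<open>
  A pattern that misses one of the adjacent letters \<open>m\<close> and \<open>M\<close> occurs already with the other one in its
  place. Using both, it would need its two largest letters in the order \<open>m\<close>, \<open>M\<close> with nothing in between;
  but 321 has them in the opposite order, and in 3142 the letter 1 separates them.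
\<close>

lemma avoids_both_insert_after_max:
  assumes avoids_both: "avoids_both (us @ m # vs)" and less: "\<And>x. x \<in> set us \<union> set vs \<Longrightarrow> x < m" and "m < M"
  shows "avoids_both (us @ m # M # vs)"
proof -
  let ?w = "us @ m # M # vs"
  have notin: "m \<notin> set us" "m \<notin> set vs" "M \<notin> set us" "M \<notin> set vs"
    using less \<open>m < M\<close> less_asym by blast+
  have neq_in: "x \<noteq> m" "x \<noteq> M" if "x \<in> set us \<union> set vs" for x using notin that by auto
  have le: "x \<le> m \<or> x = M" if "x \<in> set ?w" for x using that less by (auto intro: less_imp_le)
  have filter_M: "filter (\<lambda>x. x \<noteq> M) ?w = us @ m # vs"
    using notin \<open>m < M\<close> by (simp add: neq_in)
  have filter_m: "filter (\<lambda>x. x \<noteq> m) ?w = us @ M # vs"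
    using notin \<open>m < M\<close> by (simp add: neq_in)
  define f where "f x = (if x = m then M else x)" for x
  have "us @ M # vs = map f (us @ m # vs)"
    using notin by (auto simp: f_def intro!: map_idI[symmetric])
  moreover have "strict_mono_on {..m} f"
    using \<open>m < M\<close> by (auto simp: strict_mono_on_def f_def)
  moreover have "set (us @ m # vs) \<subseteq> {..m}" using less by (auto intro: less_imp_le)
  ultimately have avoids_both': "avoids_both (us @ M # vs)" using avoids_both_map avoids_both by metis
  show ?thesis
    unfolding avoids_both_def
  proof
    show "\<not> has_321 ?w"
    proof
      assume "has_321 ?w"
      then obtain a b c where abc: "a < b" "b < c" "subseq [c, b, a] ?w"
        unfolding has_321_def by blast
      have "M \<in> {a, b, c}"
        using subseq_filter_neq[OF abc(3), of M] avoids_both abc unfolding filter_M avoids_both_def has_321_def by auto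
      moreover have "m \<in> {a, b, c}"
        using subseq_filter_neq[OF abc(3), of m] avoids_both' abc unfolding filter_m avoids_both_def has_321_def by auto
      moreover have "a \<in> set ?w" "b \<in> set ?w" "c \<in> set ?w"
        using set_subseq[OF abc(3)] by auto
      moreover from this have "c \<le> M" using le[of c] \<open>m < M\<close> by auto
      ultimately have "c = M" using abc(1,2) by auto
      moreover from this have "b \<le> m" using le[of b] \<open>b \<in> set ?w\<close> abc(2) by auto
      ultimately have "b = m" using abc(1) \<open>m \<in> {a, b, c}\<close> \<open>m < M\<close> by auto
      with abc(3) \<open>c = M\<close> have "subseq [m, a] vs"
        using subseq_Cons_after[of M "us @ [m]" "[m, a]" vs] notin \<open>m < M\<close> by simp
      then have "m \<in> set vs" by (auto dest: set_subseq)
      with notin show False by simp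
    qed
    show "\<not> has_3142 ?w"
    proof
      assume "has_3142 ?w"
      then obtain a b c d where abc: "a < b" "b < c" "c < d" "subseq [c, a, d, b] ?w"
        unfolding has_3142_def by blast
      have "M \<in> {a, b, c, d}"
        using subseq_filter_neq[OF abc(4), of M] avoids_both abc unfolding filter_M avoids_both_def has_3142_def by auto
      moreover have "m \<in> {a, b, c, d}"
        using subseq_filter_neq[OF abc(4), of m] avoids_both' abc unfolding filter_m avoids_both_def has_3142_def by auto
      moreover have "a \<in> set ?w" "b \<in> set ?w" "c \<in> set ?w" "d \<in> set ?w"
        using set_subseq[OF abc(4)] by auto
      moreover from this have "d \<le> M" using le[of d] \<open>m < M\<close> by auto
      ultimately have "d = M" using abc(1,2,3) by auto
      moreover from this have "c \<le> m" using le[of c] \<open>c \<in> set ?w\<close> abc(3) by auto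
      ultimately have "c = m" using abc(1,2) \<open>m \<in> {a, b, c, d}\<close> \<open>m < M\<close> by auto
      with abc(4) \<open>d = M\<close> have "subseq [a, M, b] (M # vs)"
        using subseq_Cons_after[of m us "[a, M, b]" "M # vs"] notin by simp
      moreover have "a \<noteq> M" using abc \<open>d = M\<close> by simp
      ultimately have "subseq [a, M, b] vs" by (rule subseq_Cons2_neq)
      then have "M \<in> set vs" by (auto dest: set_subseq)
      with notin show False by simp
    qed
  qed
qed

definition avoiders :: "nat \<Rightarrow> nat list set" where
  "avoiders n = {w \<in> permutations_of_set {1..n}. avoids_both w}"

definition avoiders_max_inner :: "nat \<Rightarrow> nat list set" where
  "avoiders_max_inner n = {w \<in> avoiders n. last w \<noteq> n}"

lemma avoiders_iff: "w \<in> avoiders n \<longleftrightarrow> set w = {1..n} \<and> distinct w \<and> avoids_both w"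
  by (auto simp: avoiders_def permutations_of_set_def)

lemma finite_avoiders: "finite (avoiders n)"
  by (simp add: avoiders_def)

lemma finite_avoiders_max_inner: "finite (avoiders_max_inner n)"
  by (simp add: avoiders_max_inner_def finite_avoiders)

lemma avoiders_Suc_snoc:
  assumes "w \<in> avoiders (Suc n)"
  obtains v x where "w = v @ [x]" "x \<notin> set v" "distinct v" "avoids_both v" "set v = {1..Suc n} - {x}"
proof -
  have w: "set w = {1..Suc n}" "distinct w" "avoids_both w" using assms by (auto simp: avoiders_iff)
  then have "w \<noteq> []" by auto
  then obtain v x where vx: "w = v @ [x]" by (metis append_butlast_last_id)
  then have "avoids_both v" using w(3) avoids_both_subseq by blast
  with vx w that show ?thesis by auto
qed

lemma avoiders_last_max:
  "{w \<in> avoiders (Suc n). last w = Suc n} = (\<lambda>v. v @ [Suc n]) ` avoiders n"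
proof (intro equalityI subsetI)
  fix w assume w: "w \<in> {w \<in> avoiders (Suc n). last w = Suc n}"
  then have "w \<in> avoiders (Suc n)" by simp
  then obtain v x where v: "w = v @ [x]" "x \<notin> set v" "distinct v" "avoids_both v" "set v = {1..Suc n} - {x}"
    by (rule avoiders_Suc_snoc)
  with w have "x = Suc n" by simp
  moreover have "{1..Suc n} - {Suc n} = {1..n}" by auto
  ultimately have "v \<in> avoiders n" using v(3-5) by (simp only: avoiders_iff)
  with v(1) \<open>x = Suc n\<close> show "w \<in> (\<lambda>v. v @ [Suc n]) ` avoiders n" by simp
next
  fix w assume "w \<in> (\<lambda>v. v @ [Suc n]) ` avoiders n"
  then obtain v where v: "w = v @ [Suc n]" "set v = {1..n}" "distinct v" "avoids_both v"
    by (auto simp: avoiders_iff)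
  have "avoids_both w" unfolding v(1) using v by (intro avoids_both_snoc) auto
  moreover have "set w = {1..Suc n}" "distinct w"
    using v(1-3) by (simp_all add: atLeastAtMostSuc_conv)
  ultimately show "w \<in> {w \<in> avoiders (Suc n). last w = Suc n}" using v(1) by (simp add: avoiders_iff)
qed

lemma image_transpose_max:
  assumes "n \<ge> 1"
  shows "Transposition.transpose n (Suc n) ` {1..n} = {1..Suc n} - {n}"
proof -
  have "Transposition.transpose n (Suc n) ` {1..<n} = (\<lambda>x. x) ` {1..<n}"
    by (intro image_cong) auto
  moreover have "{1..n} = insert n {1..<n}" "{1..Suc n} - {n} = insert (Suc n) {1..<n}"
    using assms by auto
  ultimately show ?thesis by simp
qed

text \<open>
  Once its last letter \<open>n\<close> is removed, the word has \<open>n+1\<close> as its maximum, and the transposition renames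
  it to \<open>n\<close>, preserving the order.
\<close>

lemma avoiders_last_second_max:
  assumes "n \<ge> 1"
  shows "{w \<in> avoiders (Suc n). last w = n} =
    (\<lambda>v. map (Transposition.transpose n (Suc n)) v @ [n]) ` avoiders n"
proof (intro equalityI subsetI)
  let ?t = "Transposition.transpose n (Suc n)"
  have img: "?t ` ({1..Suc n} - {n}) = {1..n}"
    unfolding image_transpose_max[OF assms, symmetric] image_image by simp
  fix w assume w: "w \<in> {w \<in> avoiders (Suc n). last w = n}"
  then have "w \<in> avoiders (Suc n)" by simp
  then obtain v x where v: "w = v @ [x]" "x \<notin> set v" "distinct v" "avoids_both v" "set v = {1..Suc n} - {x}"
    by (rule avoiders_Suc_snoc)
  with w have x: "x = n" by simp
  have "strict_mono_on ({1..Suc n} - {n}) ?t"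
    by (auto simp: strict_mono_on_def Transposition.transpose_def)
  then have "avoids_both (map ?t v)" using avoids_both_map[of _ ?t v] v x by blast
  moreover have "set (map ?t v) = {1..n}" using img v(5) x by simp
  moreover have "distinct (map ?t v)" using v(3) by (simp add: distinct_map)
  ultimately have "map ?t v \<in> avoiders n" by (simp add: avoiders_iff)
  moreover have "w = map ?t (map ?t v) @ [n]" using v x by simp
  ultimately show "w \<in> (\<lambda>v. map ?t v @ [n]) ` avoiders n" by blast
next
  let ?t = "Transposition.transpose n (Suc n)"
  fix w assume "w \<in> (\<lambda>v. map ?t v @ [n]) ` avoiders n"
  then obtain v where v: "w = map ?t v @ [n]" "set v = {1..n}" "distinct v" "avoids_both v"
    by (auto simp: avoiders_iff)
  have img: "?t ` {1..n} = {1..Suc n} - {n}" by (rule image_transpose_max[OF assms])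
  have "strict_mono_on {1..n} ?t"
    by (auto simp: strict_mono_on_def Transposition.transpose_def)
  then have "avoids_both (map ?t v)" using avoids_both_map[of _ ?t v] v by blast
  then have "avoids_both w" unfolding v(1) using v(2) img by (intro avoids_both_snoc) auto
  moreover have "set w = {1..Suc n}" "distinct w"
    using v(1-3) img assms by (auto simp: distinct_map)
  ultimately show "w \<in> {w \<in> avoiders (Suc n). last w = n}" using v by (simp add: avoiders_iff)
qed

text \<open>
  If \<open>n\<close> came after \<open>n+1\<close>, these two and the last letter would form 321. If a letter \<open>y\<close> stood between
  \<open>n\<close> and \<open>n+1\<close>, then with a letter \<open>b\<close> after \<open>n+1\<close> there would be 3142 (when \<open>y < b\<close>) or 321 (when \<open>b < y\<close>).
\<close>

lemma avoiders_max_follows_second_max: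
  assumes w: "w \<in> avoiders (Suc n)" "last w \<noteq> Suc n" "last w \<noteq> n" and "n \<ge> 1"
  obtains us vs where "w = us @ n # Suc n # vs" "vs \<noteq> []"
proof -
  have w': "set w = {1..Suc n}" "distinct w" "\<not> has_321 w" "\<not> has_3142 w"
    using w by (auto simp: avoiders_iff avoids_both_def)
  have "Suc n \<in> set w" using w' by simp
  then obtain us vs where split: "w = us @ Suc n # vs" by (meson split_list)
  have small: "x < n" if "x \<in> set w" "x \<noteq> n" "x \<noteq> Suc n" for x using that w'(1) by auto
  from split w(2) obtain b vs' where vs: "vs = b # vs'" by (cases vs) auto
  have "n \<in> set us"
  proof (rule ccontr)
    assume "n \<notin> set us"
    moreover have "n \<in> set w" using w' \<open>n \<ge> 1\<close> by simp
    ultimately have "n \<in> set vs" using split by auto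
    then obtain p q where q: "vs = p @ n # q" by (meson split_list)
    with split w(3) obtain y q' where y: "q = y # q'" by (cases q) auto
    have "y < n" using w'(2) split q y by (intro small) auto
    moreover have "subseq [Suc n, n, y] w" unfolding split q y by (simp add: subseq_Cons_middle subseq_singleton_left)
    ultimately show False using w'(3) unfolding has_321_def by blast
  qed
  then obtain p q where us: "us = p @ n # q" by (meson split_list)
  have "q = []"
  proof (rule ccontr)
    assume "q \<noteq> []"
    then obtain y q' where y: "q = y # q'" by (cases q) auto
    have "y < n" "b < n" using w'(2) split vs us y by (auto intro!: small)
    have "y \<noteq> b" using w'(2) split vs us y by auto
    then consider "y < b" | "b < y" by linarith
    then show False
    proof cases
      case 1
      have "subseq [n, y, Suc n, b] w" unfolding split vs us y by (simp add: subseq_Cons_middle subseq_singleton_left)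
      with 1 \<open>b < n\<close> w'(4) show False unfolding has_3142_def by blast
    next
      case 2
      have "subseq [n, y, b] w" unfolding split vs us y by (simp add: subseq_Cons_middle subseq_singleton_left)
      with 2 \<open>y < n\<close> w'(3) show False unfolding has_321_def by blast
    qed
  qed
  with that[of p vs] split us vs show ?thesis by simp
qed

text \<open>
  Deleting \<open>n+1\<close> loses no information, because it stood immediately after \<open>n\<close>.
\<close>

lemma card_avoiders_last_small:
  assumes "n \<ge> 1"
  shows "card {w \<in> avoiders (Suc n). last w \<noteq> Suc n \<and> last w \<noteq> n} = card (avoiders_max_inner n)"
proof -
  let ?E = "{w \<in> avoiders (Suc n). last w \<noteq> Suc n \<and> last w \<noteq> n}"
  let ?f = "filter (\<lambda>x. x \<noteq> Suc n)"
  have E: "\<exists>us vs. w = us @ n # Suc n # vs \<and> vs \<noteq> [] \<and> ?f w = us @ n # vs \<and> n \<notin> set us \<and>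
      n \<notin> set vs" if "w \<in> ?E" for w
  proof -
    from that assms obtain us vs where w: "w = us @ n # Suc n # vs" "vs \<noteq> []"
      using avoiders_max_follows_second_max[of w n] by blast
    moreover have "distinct w" using that by (simp add: avoiders_iff)
    ultimately have "?f us = us" "?f vs = vs" "n \<notin> set us" "n \<notin> set vs"
      by (auto simp: filter_id_conv)
    moreover from this w have "?f w = us @ n # vs" by simp
    ultimately show ?thesis using w by blast
  qed
  have "bij_betw ?f ?E (avoiders_max_inner n)"
  proof (rule bij_betw_imageI)
    show "inj_on ?f ?E"
    proof (rule inj_onI)
      fix w w' assume "w \<in> ?E" "w' \<in> ?E" and eq: "?f w = ?f w'"
      then obtain us vs us' vs' where
        "w = us @ n # Suc n # vs" "?f w = us @ n # vs" "n \<notin> set us" "n \<notin> set vs"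
        "w' = us' @ n # Suc n # vs'" "?f w' = us' @ n # vs'"
        using E by meson
      with eq show "w = w'" by (simp add: append_Cons_eq_iff)
    qed
    show "?f ` ?E = avoiders_max_inner n"
    proof (intro equalityI subsetI)
      fix v assume "v \<in> ?f ` ?E"
      then obtain w where w: "w \<in> ?E" "v = ?f w" by blast
      from E[OF w(1)] obtain us vs where us: "w = us @ n # Suc n # vs" "vs \<noteq> []" "v = us @ n # vs"
          "n \<notin> set vs" using w(2) by blast
      have "set v = {1..n}" "distinct v" "avoids_both v"
        using w avoids_both_subseq[of w v] by (auto simp: avoiders_iff)
      moreover have "last v \<noteq> n" using us last_in_set[of vs] by auto
      ultimately show "v \<in> avoiders_max_inner n" by (simp add: avoiders_max_inner_def avoiders_iff)
    next
      fix v assume "v \<in> avoiders_max_inner n"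
      then have v: "set v = {1..n}" "distinct v" "avoids_both v" "last v \<noteq> n"
        by (auto simp: avoiders_max_inner_def avoiders_iff)
      have "n \<in> set v" using v assms by simp
      then obtain us vs where split: "v = us @ n # vs" by (meson split_list)
      have "vs \<noteq> []" using v split by auto
      let ?w = "us @ n # Suc n # vs"
      have less: "x < n" if "x \<in> set us \<union> set vs" for x
      proof -
        have "x \<in> set v" "x \<noteq> n" using that v(2) split by auto
        then show ?thesis using v(1) by auto
      qed
      have "avoids_both ?w" by (rule avoids_both_insert_after_max) (use v split less in auto)
      moreover have "set ?w = {1..Suc n}"
      proof -
        have "set ?w = insert (Suc n) (set v)" using split by auto
        also have "\<dots> = {1..Suc n}" unfolding v(1) by (simp add: atLeastAtMostSuc_conv)
        finally show ?thesis .
      qed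
      moreover have "distinct ?w" using v(2) split less by force
      moreover have "last ?w \<noteq> n" "last ?w \<noteq> Suc n"
        using \<open>vs \<noteq> []\<close> less[of "last vs"] by auto
      moreover have "?f ?w = v"
      proof -
        have "x \<noteq> Suc n" if "x \<in> set us \<union> set vs" for x using less[OF that] by simp
        then have "?f us = us" "?f vs = vs" by (auto simp: filter_id_conv)
        then show ?thesis using split by simp
      qed
      ultimately show "v \<in> ?f ` ?E" by (intro image_eqI[of _ _ ?w]) (auto simp: avoiders_iff)
    qed
  qed
  then show ?thesis by (rule bij_betw_same_card)
qed

lemma card_avoiders_max_inner_Suc:
  assumes "n \<ge> 1"
  shows "card (avoiders_max_inner (Suc n)) = card (avoiders n) + card (avoiders_max_inner n)"
proof -
  let ?A = "{w \<in> avoiders (Suc n). last w = n}"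
  let ?E = "{w \<in> avoiders (Suc n). last w \<noteq> Suc n \<and> last w \<noteq> n}"
  have "avoiders_max_inner (Suc n) = ?A \<union> ?E" by (auto simp: avoiders_max_inner_def)
  moreover have "card (?A \<union> ?E) = card ?A + card ?E"
    using finite_avoiders by (intro card_Un_disjoint) auto
  moreover have "card ?A = card (avoiders n)"
    unfolding avoiders_last_second_max[OF assms]
    by (intro card_image inj_onI) (metis append1_eq_conv inj_map_eq_map inj_transpose)
  ultimately show ?thesis using card_avoiders_last_small[OF assms] by simp
qed

lemma card_avoiders_Suc:
  "card (avoiders (Suc n)) = card (avoiders n) + card (avoiders_max_inner (Suc n))"
proof -
  let ?A = "{w \<in> avoiders (Suc n). last w = Suc n}"
  have "avoiders (Suc n) = ?A \<union> avoiders_max_inner (Suc n)" by (auto simp: avoiders_max_inner_def)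
  moreover have "card (?A \<union> avoiders_max_inner (Suc n)) = card ?A + card (avoiders_max_inner (Suc n))"
    using finite_avoiders finite_avoiders_max_inner
    by (intro card_Un_disjoint) (auto simp: avoiders_max_inner_def)
  moreover have "card ?A = card (avoiders n)"
    unfolding avoiders_last_max by (intro card_image inj_onI) simp
  ultimately show ?thesis by simp
qed

lemma card_avoiders_fib:
  "card (avoiders (Suc n)) = fib (2 * n + 1) \<and> card (avoiders_max_inner (Suc n)) = fib (2 * n)"
proof (induction n)
  case 0
  have "avoids_both [1]" unfolding avoids_both_def has_321_def has_3142_def by simp
  moreover have "permutations_of_set {1..Suc 0} = {[1]}" by simp
  ultimately have "avoiders (Suc 0) = {[1]}" unfolding avoiders_def by auto
  then show ?case by (simp add: avoiders_max_inner_def)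
next
  case (Suc n)
  then have "card (avoiders_max_inner (Suc (Suc n))) = fib (2 * Suc n)"
    by (simp add: card_avoiders_max_inner_Suc)
  with Suc show ?case by (simp add: card_avoiders_Suc[of "Suc n"])
qed

theorem theorem3p6:
  fixes n :: nat
  assumes "n \<ge> 2"
  shows "avoider_count n [3, 2, 1] alpha = fib (2 * n - 1)"
proof -
  let ?S = "{\<sigma> \<in> {\<sigma>. \<sigma> permutes {1..n}}. avoids_both (one_line n \<sigma>)}"
  have iff: "\<not> contains_pattern n \<sigma> [3, 2, 1] \<and> \<not> contains_arrow_pattern n \<sigma> alpha \<longleftrightarrow>
      avoids_both (one_line n \<sigma>)" if "\<sigma> permutes {1..n}" for \<sigma>
    unfolding contains_321_iff avoids_both_def using contains_alpha_iff_3142[OF that] by blast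
  have "avoider_count n [3, 2, 1] alpha = card ?S"
    unfolding avoider_count_def mem_Collect_eq
    by (intro arg_cong[of _ _ card] Collect_cong conj_cong refl iff)
  moreover have "bij_betw (one_line n) ?S (avoiders n)"
  proof (rule bij_betw_subset[OF one_line_bij[of n]])
    have "one_line n ` ?S = {w \<in> one_line n ` {\<sigma>. \<sigma> permutes {1..n}}. avoids_both w}"
      by blast
    then show "one_line n ` ?S = avoiders n"
      by (simp only: avoiders_def bij_betw_imp_surj_on[OF one_line_bij])
  qed (rule Collect_restrict)
  then have "card ?S = card (avoiders n)" by (rule bij_betw_same_card)
  moreover obtain m where "n = Suc m" using assms by (cases n) auto
  then have "card (avoiders n) = fib (2 * n - 1)" using card_avoiders_fib[of m] by simp
  ultimately show ?thesis by (simp only:)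
qed

end
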